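(* Let $q$ be a prime power and let $n,m$ be integers with $1\le m\le n-1$. Let $\epsilon \ge 0$ be a real number and let $t\ge 2$ be an integer. Let $P\subseteq \mathbb{F}_q^n$ with $$|P| \geq (1+\epsilon)(t-1)q^{n-m}.$$ Then the number $\Gamma_t(P)$ of $t$-rich $m$-flats satisfies $$\Gamma_t(P) \geq a_{\epsilon,t}\, q^{(m+1)(n-m)},\qquad\text{where}\qquad a_{\epsilon,t} = \frac{\epsilon^2(t-1)}{\epsilon^2(t-1) + (1+\epsilon)}.$$
   Context: $\mathbb{F}_q$ is the finite field with $q$ elements. An $m$-flat in $\mathbb{F}_q^n$ is an $m$-dimensional affine subspace of $\mathbb{F}_q^n$. Given $P\subseteq\mathbb{F}_q^n$, an $m$-flat is $t$-rich if it contains at least $t$ points of $P$, and $\Gamma_t(P)$ denotes the number of $t$-rich $m$-flats in $\mathbb{F}_q^n$. *)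

theory Defs
  imports "HOL-Analysis.Cartesian_Space"
begin

text \<open>
  The space \<open>F\<^sub>q\<^sup>n\<close> is the type \<open>'a ^ 'n\<close> for a finite field \<open>'a\<close> with \<open>q = CARD('a)\<close> and
  \<open>n = CARD('n)\<close>. The library constant \<open>affine\<close> is restricted to real vector spaces, so flats
  are defined as translates of linear subspaces over \<open>'a\<close>.
\<close>

definition is_flat :: "nat \<Rightarrow> ('a::field ^ 'n) set \<Rightarrow> bool" where
  "is_flat m F \<longleftrightarrow> (\<exists>v W. vec.subspace W \<and> vec.dim W = m \<and> F = (\<lambda>w. v + w) ` W)"

definition rich :: "nat \<Rightarrow> ('a::finite ^ 'n) set \<Rightarrow> ('a ^ 'n) set \<Rightarrow> bool" where
  "rich t P F \<longleftrightarrow> t \<le> card (F \<inter> P)"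

definition num_rich_flats :: "nat \<Rightarrow> nat \<Rightarrow> ('a::{field,finite} ^ 'n) set \<Rightarrow> nat" where
  "num_rich_flats m t P = card {F. is_flat m F \<and> rich t P F}"

definition rich_coeff :: "real \<Rightarrow> nat \<Rightarrow> real" where
  "rich_coeff \<epsilon> t = \<epsilon>\<^sup>2 * (real t - 1) / (\<epsilon>\<^sup>2 * (real t - 1) + (1 + \<epsilon>))"

end

theory Submission
  imports Defs "HOL-Analysis.Convex"
begin

text \<open>
  Fix a set \<open>S\<close> of \<open>m\<close> coordinates and consider only those \<open>m\<close>-flats that are graphs of affine
  maps from the coordinates in \<open>S\<close> to the remaining \<open>n - m\<close> coordinates (\<open>is_flat_graph_flat\<close>).
  Distinct maps have distinct graphs (\<open>inj_on_graph_flat\<close>), so there are exactly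
  \<open>N = q\<^bsup>(m+1)(n-m)\<^esup>\<close> of them, which is the quantity in the bound. It therefore suffices that a
  proportion \<open>a\<close> of the graphs is \<open>t\<close>-rich, where \<open>a\<close> is the coefficient in the bound.

  A uniformly random graph behaves like a pairwise independent hash family. With \<open>D = q\<^bsup>n-m\<^esup>\<close>, a
  point lies on it with probability \<open>1/D\<close> (\<open>card_graphs_through\<close>), and two distinct points both
  lie on it with probability at most \<open>1/D\<^sup>2\<close> (\<open>card_graphs_through_two\<close>): exactly \<open>1/D\<^sup>2\<close> if they
  differ in some coordinate of \<open>S\<close>, and \<open>0\<close> otherwise, because a graph contains one point over each
  choice of the coordinates in \<open>S\<close>. Hence the number \<open>X\<close> of points of \<open>P\<close> on the graph has
  mean \<open>\<mu> = |P|/D\<close> and variance at most \<open>\<mu>\<close>.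

  With \<open>s = t - 1\<close>, the graph is rich when \<open>X > s\<close>. Cantelli's one-sided inequality bounds the
  probability of this event from below by \<open>(\<mu> - s)\<^sup>2 / (\<mu> + (\<mu> - s)\<^sup>2)\<close>. This is increasing in
  \<open>\<mu> \<ge> s\<close>, and its value at \<open>\<mu> = (1 + \<epsilon>) s\<close> is \<open>a\<close> (\<open>second_moment_bound\<close>).
\<close>

section \<open>A lower bound from the first two moments\<close>

text \<open>
  Values with \<open>X k \<le> s\<close> only decrease the sum of \<open>X k - s\<close>, so the sum over the values exceeding
  \<open>s\<close> is at least \<open>N (\<mu> - s)\<close>. The Cauchy--Schwarz inequality against the indicator of these
  values turns this into a lower bound for their number.
\<close>

lemma cantelli_count:
  fixes X :: "'k \<Rightarrow> real" and \<mu> s :: real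
  assumes K: "finite K"
    and mean: "(\<Sum>k\<in>K. X k) = real (card K) * \<mu>"
    and second: "(\<Sum>k\<in>K. (X k)\<^sup>2) \<le> real (card K) * (\<mu> + \<mu>\<^sup>2)"
    and "s \<le> \<mu>"
  shows "real (card K) * (\<mu> - s)\<^sup>2 \<le> real (card {k \<in> K. s < X k}) * (\<mu> + (\<mu> - s)\<^sup>2)"
proof (cases "card K = 0")
  case True
  with K have "K = {}" by simp
  then show ?thesis by simp
next
  case False
  define N where "N = real (card K)"
  have N: "N > 0" using False by (simp add: N_def)
  define G where "G = {k \<in> K. s < X k}"
  have G: "G \<subseteq> K" "finite G" using K by (auto simp: G_def)
  have "N * (\<mu> - s) = (\<Sum>k\<in>K. X k - s)"
    using mean by (simp add: sum_subtractf N_def algebra_simps)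
  also have "\<dots> = (\<Sum>k\<in>K - G. X k - s) + (\<Sum>k\<in>G. X k - s)"
    using K G by (simp add: sum.subset_diff)
  also have "\<dots> \<le> (\<Sum>k\<in>G. X k - s)"
  proof -
    have "(\<Sum>k\<in>K - G. X k - s) \<le> 0" by (rule sum_nonpos) (auto simp: G_def)
    then show ?thesis by simp
  qed
  finally have "(N * (\<mu> - s))\<^sup>2 \<le> (\<Sum>k\<in>G. (X k - s) * 1)\<^sup>2"
    using N \<open>s \<le> \<mu>\<close> by (intro power_mono) auto
  also have "\<dots> \<le> (\<Sum>k\<in>G. (X k - s)\<^sup>2) * (\<Sum>k\<in>G. 1\<^sup>2)"
    by (rule Cauchy_Schwarz_ineq_sum)
  also have "\<dots> \<le> (\<Sum>k\<in>K. (X k - s)\<^sup>2) * real (card G)"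
    using K G by (auto intro!: mult_right_mono sum_mono2)
  also have "(\<Sum>k\<in>K. (X k - s)\<^sup>2) = (\<Sum>k\<in>K. (X k)\<^sup>2) - 2 * s * (\<Sum>k\<in>K. X k) + N * s\<^sup>2"
    by (simp add: power2_diff sum.distrib sum_subtractf N_def mult.commute mult.left_commute
        flip: sum_distrib_left sum_distrib_right)
  also have "\<dots> \<le> N * (\<mu> + (\<mu> - s)\<^sup>2)"
    using second unfolding mean N_def[symmetric] by (simp add: power2_eq_square algebra_simps)
  finally have "(N * (\<mu> - s))\<^sup>2 \<le> N * (\<mu> + (\<mu> - s)\<^sup>2) * real (card G)"
    by (simp add: mult_right_mono)
  then have "N * (N * (\<mu> - s)\<^sup>2) \<le> N * (real (card G) * (\<mu> + (\<mu> - s)\<^sup>2))"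
    by (simp add: power2_eq_square algebra_simps)
  then show ?thesis
    using N by (simp add: N_def G_def)
qed

text \<open>
  The bound of \<open>cantelli_count\<close> is weakest at the smallest admissible mean \<open>\<mu> = (1 + \<epsilon>) s\<close>,
  where the factor \<open>s\<close> cancels and the stated proportion remains.
\<close>

lemma second_moment_bound:
  fixes X :: "'k \<Rightarrow> real" and \<mu> s \<epsilon> :: real
  assumes K: "finite K"
    and mean: "(\<Sum>k\<in>K. X k) = real (card K) * \<mu>"
    and second: "(\<Sum>k\<in>K. (X k)\<^sup>2) \<le> real (card K) * (\<mu> + \<mu>\<^sup>2)"
    and s: "0 < s" and \<epsilon>: "0 \<le> \<epsilon>" and \<mu>: "(1 + \<epsilon>) * s \<le> \<mu>"
  shows "\<epsilon>\<^sup>2 * s / (\<epsilon>\<^sup>2 * s + (1 + \<epsilon>)) * real (card K) \<le> real (card {k \<in> K. s < X k})"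
proof -
  define N where "N = real (card K)"
  define g where "g = real (card {k \<in> K. s < X k})"
  define \<delta> where "\<delta> = \<mu> - (1 + \<epsilon>) * s"
  have \<delta>: "\<delta> \<ge> 0" and \<mu>_eq: "\<mu> = (1 + \<epsilon>) * s + \<delta>" using \<mu> by (auto simp: \<delta>_def)
  have "s \<le> (1 + \<epsilon>) * s" using s \<epsilon> by (simp add: algebra_simps)
  then have s\<mu>: "s \<le> \<mu>" using \<mu> by linarith
  have main: "N * (\<mu> - s)\<^sup>2 \<le> g * (\<mu> + (\<mu> - s)\<^sup>2)"
    unfolding N_def g_def using cantelli_count[OF K mean second s\<mu>] .
  \<comment> \<open>In terms of the excess \<open>\<delta>\<close> over the smallest admissible mean, every term on the right is nonnegative.\<close>
  have "(1 + \<epsilon>) * (\<mu> - s)\<^sup>2 - \<epsilon>\<^sup>2 * s * \<mu> = (2 * \<epsilon> + \<epsilon>\<^sup>2) * s * \<delta> + (1 + \<epsilon>) * \<delta>\<^sup>2"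
    unfolding \<mu>_eq by (simp add: power2_eq_square algebra_simps)
  then have ratio: "\<epsilon>\<^sup>2 * s * \<mu> \<le> (1 + \<epsilon>) * (\<mu> - s)\<^sup>2"
    using s \<epsilon> \<delta> by (smt (verit) mult_nonneg_nonneg zero_le_power2)
  define M where "M = \<mu> + (\<mu> - s)\<^sup>2"
  have M: "M > 0" using s s\<mu> unfolding M_def by (intro add_pos_nonneg) auto
  have pos: "\<epsilon>\<^sup>2 * s + (1 + \<epsilon>) > 0" using s \<epsilon> by (simp add: add_nonneg_pos)
  have "\<epsilon>\<^sup>2 * s * M \<le> (\<mu> - s)\<^sup>2 * (\<epsilon>\<^sup>2 * s + (1 + \<epsilon>))"
    using ratio by (simp add: M_def algebra_simps)
  then have "\<epsilon>\<^sup>2 * s / (\<epsilon>\<^sup>2 * s + (1 + \<epsilon>)) \<le> (\<mu> - s)\<^sup>2 / M"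
    using M pos by (simp add: field_simps)
  then have "\<epsilon>\<^sup>2 * s / (\<epsilon>\<^sup>2 * s + (1 + \<epsilon>)) * N \<le> (\<mu> - s)\<^sup>2 / M * N"
    by (rule mult_right_mono) (simp add: N_def)
  also have "\<dots> \<le> g"
    using main M by (simp add: M_def[symmetric] divide_simps mult.commute)
  finally show ?thesis by (simp add: N_def g_def)
qed

section \<open>Affine functions of the coordinates in a set\<close>

text \<open>
  A pair \<open>(b, a)\<close> stands for the affine function \<open>b + \<Sum>j\<in>S. a j * x$j\<close>. The coefficients are
  extensional outside \<open>S\<close>, so that distinct pairs are distinct functions.
\<close>

definition affine_funs :: "'n set \<Rightarrow> ('a \<times> ('n \<Rightarrow> 'a)) set" where
  "affine_funs S = UNIV \<times> (S \<rightarrow>\<^sub>E UNIV)"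

definition affine_val :: "'n set \<Rightarrow> 'a \<times> ('n \<Rightarrow> 'a) \<Rightarrow> 'a::field ^ 'n \<Rightarrow> 'a" where
  "affine_val S c x = fst c + (\<Sum>j\<in>S. snd c j * x $ j)"

lemma card_affine_funs:
  "card (affine_funs S :: ('a::finite \<times> ('n::finite \<Rightarrow> 'a)) set) = CARD('a) ^ (card S + 1)"
  by (simp add: affine_funs_def card_cartesian_product card_funcsetE)

text \<open>The linear coefficients can be chosen freely; the constant term is then determined.\<close>

lemma card_affine_funs_through:
  fixes x :: "'a::{field,finite} ^ 'n"
  shows "card {c \<in> affine_funs S. affine_val S c x = y} = CARD('a) ^ card S"
proof -
  have "bij_betw snd {c \<in> affine_funs S. affine_val S c x = y} (S \<rightarrow>\<^sub>E UNIV)"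
    by (rule bij_betw_byWitness[where f' = "\<lambda>a. (y - (\<Sum>j\<in>S. a j * x $ j), a)"])
      (auto simp: affine_funs_def affine_val_def)
  then have "card {c \<in> affine_funs S. affine_val S c x = y} = card (S \<rightarrow>\<^sub>E (UNIV :: 'a set))"
    by (rule bij_betw_same_card)
  then show ?thesis by (simp add: card_funcsetE)
qed

text \<open>
  If \<open>x\<close> and \<open>x'\<close> differ at \<open>j\<close>, then subtracting the two prescribed values shows that the coefficient
  at \<open>j\<close> is determined by the other linear coefficients. The constant term then follows from either
  value.
\<close>

lemma card_affine_funs_through_two:
  fixes x x' :: "'a::{field,finite} ^ 'n"
  assumes j: "j \<in> S" "x $ j \<noteq> x' $ j"
  shows "card {c \<in> affine_funs S. affine_val S c x = y \<and> affine_val S c x' = y'}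
    \<le> CARD('a) ^ (card S - 1)"
proof -
  let ?C = "{c \<in> affine_funs S. affine_val S c x = y \<and> affine_val S c x' = y'}"
  have "inj_on (\<lambda>c. restrict (snd c) (S - {j})) ?C"
  proof (rule inj_onI)
    fix c d assume c: "c \<in> ?C" and d: "d \<in> ?C"
      and eq: "restrict (snd c) (S - {j}) = restrict (snd d) (S - {j})"
    have off: "snd c i = snd d i" if "i \<in> S - {j}" for i
      using fun_cong[OF eq, of i] that by simp
    have diff: "(\<Sum>i\<in>S. snd e i * (x $ i - x' $ i)) = y - y'" if "e \<in> ?C" for e
      using that by (auto simp: affine_val_def right_diff_distrib sum_subtractf)
    have split: "(\<Sum>i\<in>S. snd e i * (x $ i - x' $ i))
        = snd e j * (x $ j - x' $ j) + (\<Sum>i\<in>S - {j}. snd e i * (x $ i - x' $ i))" for e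
      using j by (simp add: sum.remove)
    define r where "r = (\<Sum>i\<in>S - {j}. snd c i * (x $ i - x' $ i))"
    have r: "r = (\<Sum>i\<in>S - {j}. snd d i * (x $ i - x' $ i))"
      unfolding r_def by (rule sum.cong) (auto simp: off)
    have "snd c j * (x $ j - x' $ j) + r = y - y'"
      using diff[OF c] unfolding split r_def .
    moreover have "snd d j * (x $ j - x' $ j) + r = y - y'"
      using diff[OF d] unfolding split r .
    ultimately have "snd c j * (x $ j - x' $ j) + r = snd d j * (x $ j - x' $ j) + r"
      by (rule trans[OF _ sym])
    then have "snd c j * (x $ j - x' $ j) = snd d j * (x $ j - x' $ j)"
      by (rule add_right_imp_eq)
    then have on: "snd c j = snd d j" using j by simp
    have "snd c i = snd d i" for i
      using c d off[of i] on by (cases "i \<in> S"; cases "i = j")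
        (auto simp: affine_funs_def PiE_iff extensional_def)
    then have snd: "snd c = snd d" by blast
    then have "fst c = fst d"
      using c d by (auto simp: affine_val_def)
    with snd show "c = d" by (simp add: prod_eq_iff)
  qed
  moreover have "(\<lambda>c. restrict (snd c) (S - {j})) ` ?C \<subseteq> (S - {j}) \<rightarrow>\<^sub>E UNIV"
    by (rule image_subsetI) (simp add: PiE_iff)
  ultimately have "card ?C \<le> card ((S - {j}) \<rightarrow>\<^sub>E (UNIV :: 'a set))"
    by (intro card_inj_on_le) auto
  then show ?thesis using j by (simp add: card_funcsetE)
qed

section \<open>Graphs of affine maps as flats\<close>

definition affine_maps :: "'n set \<Rightarrow> ('n \<Rightarrow> 'a \<times> ('n \<Rightarrow> 'a)) set" where
  "affine_maps S = (- S) \<rightarrow>\<^sub>E affine_funs S"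

definition graph_flat :: "'n set \<Rightarrow> ('n \<Rightarrow> 'a \<times> ('n \<Rightarrow> 'a)) \<Rightarrow> ('a::field ^ 'n) set" where
  "graph_flat S k = {x. \<forall>i\<in>- S. x $ i = affine_val S (k i) x}"

lemma card_affine_maps:
  "card (affine_maps S :: ('n::finite \<Rightarrow> 'a::finite \<times> ('n \<Rightarrow> 'a)) set)
    = (CARD('a) ^ (card S + 1)) ^ card (- S)"
  by (simp add: affine_maps_def card_PiE card_affine_funs)

text \<open>
  The direction space is the image of the coordinate subspace spanned by \<open>S\<close> under the linear map
  that fills in the remaining coordinates. This map leaves the coordinates in \<open>S\<close> alone, so it is
  injective on the coordinate subspace and preserves its dimension.
\<close>

lemma is_flat_graph_flat:
  fixes k :: "'n::finite \<Rightarrow> 'a::field \<times> ('n \<Rightarrow> 'a)"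
  shows "is_flat (card S) (graph_flat S k)"
proof -
  define U :: "('a ^ 'n) set" where "U = {x. \<forall>i. i \<notin> S \<longrightarrow> x $ i = 0}"
  define g :: "'a ^ 'n \<Rightarrow> 'a ^ 'n"
    where "g x = (\<chi> i. if i \<in> S then x $ i else \<Sum>j\<in>S. snd (k i) j * x $ j)" for x
  define v :: "'a ^ 'n" where "v = (\<chi> i. if i \<in> S then 0 else fst (k i))"
  have U: "vec.subspace U"
    by (simp add: vec.subspace_def U_def)
  have lin: "Vector_Spaces.linear (*s) (*s) g"
    by unfold_locales
      (auto simp: g_def vec_eq_iff sum.distrib sum_distrib_left algebra_simps)
  have "inj_on g U"
    by (rule inj_onI) (auto simp: g_def U_def vec_eq_iff, metis)
  moreover have "vec.span U = U" using U by (simp add: vec.span_eq_iff)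
  ultimately have "inj_on g (vec.span U)" by (simp only:)
  then have "vec.dim (g ` U) = vec.dim U"
    by (rule vec.dim_image_eq[OF lin])
  also have "\<dots> = card S" unfolding U_def by (rule dim_substandard_cart)
  finally have dim: "vec.dim (g ` U) = card S" .
  have sub: "vec.subspace (g ` U)"
    using U lin by (intro vec.linear_subspace_image)
  have "graph_flat S k = (\<lambda>w. v + w) ` (g ` U)"
  proof (intro equalityI subsetI)
    fix x assume x: "x \<in> graph_flat S k"
    define u :: "'a ^ 'n" where "u = (\<chi> i. if i \<in> S then x $ i else 0)"
    have "u \<in> U" by (simp add: u_def U_def)
    moreover have "x = v + g u"
      using x by (auto simp: graph_flat_def affine_val_def vec_eq_iff v_def g_def u_def)
    ultimately show "x \<in> (\<lambda>w. v + w) ` (g ` U)" by blast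
  next
    fix x assume "x \<in> (\<lambda>w. v + w) ` (g ` U)"
    then obtain u where "x = v + g u" by blast
    then show "x \<in> graph_flat S k"
      by (simp add: graph_flat_def affine_val_def v_def g_def)
  qed
  with sub dim show ?thesis unfolding is_flat_def by blast
qed

text \<open>
  The point of the graph over a given choice of the coordinates in \<open>S\<close> shows the value of the map
  there. The origin and the unit vectors therefore reveal the constant terms and the linear
  coefficients.
\<close>

lemma inj_on_graph_flat:
  "inj_on (graph_flat S) (affine_maps S :: ('n::finite \<Rightarrow> 'a::field \<times> ('n \<Rightarrow> 'a)) set)"
proof (rule inj_onI)
  fix k l :: "'n \<Rightarrow> 'a \<times> ('n \<Rightarrow> 'a)"
  assume k: "k \<in> affine_maps S" and l: "l \<in> affine_maps S" and eq: "graph_flat S k = graph_flat S l"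
  have val: "affine_val S (k i) x = affine_val S (l i) x" if i: "i \<notin> S" for i x
  proof -
    define p :: "'a ^ 'n" where "p = (\<chi> i. if i \<in> S then x $ i else affine_val S (k i) x)"
    have p: "affine_val S c p = affine_val S c x" for c
      by (simp add: affine_val_def p_def)
    have "p \<in> graph_flat S k"
      by (simp add: graph_flat_def p) (simp add: p_def)
    then have "p \<in> graph_flat S l" by (simp add: eq)
    then have "p $ i = affine_val S (l i) x" using i by (simp add: graph_flat_def p)
    then show ?thesis using i by (simp add: p_def)
  qed
  show "k = l"
  proof
    fix i
    show "k i = l i"
    proof (cases "i \<in> S")
      case True
      then have "i \<notin> - S" by simp
      then show ?thesis
        using k l unfolding affine_maps_def by (metis PiE_arb)
    next
      case False
      have fst: "fst (k i) = fst (l i)"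
        using val[OF False, of 0] by (simp add: affine_val_def)
      have "snd (k i) j = snd (l i) j" for j
      proof (cases "j \<in> S")
        case True
        have "affine_val S c (axis j 1) = fst c + snd c j" for c :: "'a \<times> ('n \<Rightarrow> 'a)"
          using True by (simp add: affine_val_def axis_def if_distrib cong: if_cong)
        then show ?thesis using val[OF False, of "axis j 1"] fst by simp
      next
        case notin: False
        have "snd (k i) \<in> S \<rightarrow>\<^sub>E UNIV" "snd (l i) \<in> S \<rightarrow>\<^sub>E UNIV"
          using k l False by (auto simp: affine_maps_def affine_funs_def PiE_iff mem_Times_iff)
        with notin show ?thesis by (metis PiE_arb)
      qed
      with fst show ?thesis by (simp add: prod_eq_iff fun_eq_iff)
    qed
  qed
qed

section \<open>Incidences between points and graphs\<close>

lemma card_graphs_through: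
  fixes x :: "'a::{field,finite} ^ 'n"
  shows "card {k \<in> affine_maps S. x \<in> graph_flat S k} = (CARD('a) ^ card S) ^ card (- S)"
proof -
  have "{k \<in> affine_maps S. x \<in> graph_flat S k}
      = (\<Pi>\<^sub>E i\<in>- S. {c \<in> affine_funs S. affine_val S c x = x $ i})"
    by (auto simp: affine_maps_def graph_flat_def PiE_iff extensional_def)
  then show ?thesis by (simp add: card_PiE card_affine_funs_through)
qed

text \<open>
  If the points differ at some \<open>j \<in> S\<close>, then each coordinate outside \<open>S\<close> independently restricts its
  affine function to at most \<open>q\<^bsup>m-1\<^esup>\<close> choices. If they agree on \<open>S\<close>, a graph through both would force
  them to agree everywhere.
\<close>

lemma card_graphs_through_two:
  fixes x y :: "'a::{field,finite} ^ 'n"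
  assumes "x \<noteq> y"
  shows "card {k \<in> affine_maps S. x \<in> graph_flat S k \<and> y \<in> graph_flat S k}
    \<le> (CARD('a) ^ (card S - 1)) ^ card (- S)"
proof (cases "\<exists>j\<in>S. x $ j \<noteq> y $ j")
  case True
  then obtain j where j: "j \<in> S" "x $ j \<noteq> y $ j" by blast
  have "{k \<in> affine_maps S. x \<in> graph_flat S k \<and> y \<in> graph_flat S k}
      = (\<Pi>\<^sub>E i\<in>- S. {c \<in> affine_funs S. affine_val S c x = x $ i \<and> affine_val S c y = y $ i})"
    by (auto simp: affine_maps_def graph_flat_def PiE_iff extensional_def)
  then have "card {k \<in> affine_maps S. x \<in> graph_flat S k \<and> y \<in> graph_flat S k}
      = (\<Prod>i\<in>- S. card {c \<in> affine_funs S. affine_val S c x = x $ i \<and> affine_val S c y = y $ i})"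
    by (simp add: card_PiE)
  also have "\<dots> \<le> (\<Prod>i\<in>- S. CARD('a) ^ (card S - 1))"
    by (intro prod_mono conjI card_affine_funs_through_two[OF j]) simp
  finally show ?thesis by simp
next
  case False
  have "\<not> (x \<in> graph_flat S k \<and> y \<in> graph_flat S k)" for k
  proof
    assume xy: "x \<in> graph_flat S k \<and> y \<in> graph_flat S k"
    have "affine_val S c x = affine_val S c y" for c
      using False by (simp add: affine_val_def)
    then have "x $ i = y $ i" for i
      using xy False by (cases "i \<in> S") (auto simp: graph_flat_def)
    with \<open>x \<noteq> y\<close> show False by (simp add: vec_eq_iff)
  qed
  then have "{k \<in> affine_maps S. x \<in> graph_flat S k \<and> y \<in> graph_flat S k} = {}"
    by blast
  then show ?thesis by (simp only: card.empty)
qed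

lemma sum_card_graph_flat:
  fixes P :: "('a::{field,finite} ^ 'n) set"
  shows "(\<Sum>k\<in>affine_maps S. card (graph_flat S k \<inter> P))
    = card P * (CARD('a) ^ card S) ^ card (- S)"
proof -
  have "(\<Sum>k\<in>affine_maps S. card (graph_flat S k \<inter> P))
      = (\<Sum>k\<in>affine_maps S. \<Sum>p\<in>P. of_bool (p \<in> graph_flat S k))"
    by (simp add: Int_commute)
  also have "\<dots> = (\<Sum>p\<in>P. \<Sum>k\<in>affine_maps S. of_bool (p \<in> graph_flat S k))"
    by (rule sum.swap)
  also have "\<dots> = (\<Sum>p\<in>P. card {k \<in> affine_maps S. p \<in> graph_flat S k})"
    by (simp add: Collect_conj_eq)
  finally show ?thesis by (simp add: card_graphs_through)
qed

text \<open>
  The square counts ordered pairs of points on the graph. The diagonal pairs contribute the first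
  moment, which is the first summand.
\<close>

lemma sum_card_graph_flat_square:
  fixes P :: "('a::{field,finite} ^ 'n) set"
  shows "(\<Sum>k\<in>affine_maps S. (card (graph_flat S k \<inter> P))\<^sup>2)
    \<le> card P * (CARD('a) ^ card S) ^ card (- S)
      + (card P)\<^sup>2 * (CARD('a) ^ (card S - 1)) ^ card (- S)"
proof -
  define A where "A = (CARD('a) ^ card S) ^ card (- S)"
  define B where "B = (CARD('a) ^ (card S - 1)) ^ card (- S)"
  have "(\<Sum>k\<in>affine_maps S. (card (graph_flat S k \<inter> P))\<^sup>2)
      = (\<Sum>k\<in>affine_maps S. \<Sum>z\<in>P \<times> P. of_bool (fst z \<in> graph_flat S k \<and> snd z \<in> graph_flat S k))"
  proof (rule sum.cong)
    fix k :: "'n \<Rightarrow> 'a \<times> ('n \<Rightarrow> 'a)"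
    have "P \<times> P \<inter> {z. fst z \<in> graph_flat S k \<and> snd z \<in> graph_flat S k}
        = (graph_flat S k \<inter> P) \<times> (graph_flat S k \<inter> P)" by auto
    then show "(card (graph_flat S k \<inter> P))\<^sup>2
        = (\<Sum>z\<in>P \<times> P. of_bool (fst z \<in> graph_flat S k \<and> snd z \<in> graph_flat S k))"
      by (simp add: card_cartesian_product power2_eq_square)
  qed simp
  also have "\<dots> = (\<Sum>z\<in>P \<times> P. \<Sum>k\<in>affine_maps S.
      of_bool (fst z \<in> graph_flat S k \<and> snd z \<in> graph_flat S k))"
    by (rule sum.swap)
  also have "\<dots> = (\<Sum>(x, y)\<in>P \<times> P.
      card {k \<in> affine_maps S. x \<in> graph_flat S k \<and> y \<in> graph_flat S k})"
    by (simp add: Collect_conj_eq case_prod_unfold)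
  also have "\<dots> \<le> (\<Sum>(x, y)\<in>P \<times> P. (if x = y then A else 0) + B)"
  proof (rule sum_mono, clarify)
    fix x y :: "'a ^ 'n"
    show "card {k \<in> affine_maps S. x \<in> graph_flat S k \<and> y \<in> graph_flat S k}
        \<le> (if x = y then A else 0) + B"
      using card_graphs_through[of S x] card_graphs_through_two[of x y S]
      by (auto simp: A_def B_def)
  qed
  also have "\<dots> = (\<Sum>x\<in>P. \<Sum>y\<in>P. (if x = y then A else 0) + B)"
    by (rule sum.cartesian_product[symmetric])
  also have "\<dots> = card P * A + (card P)\<^sup>2 * B"
    by (simp add: sum.distrib power2_eq_square algebra_simps)
  finally show ?thesis by (simp add: A_def B_def)
qed

section \<open>The number of rich flats\<close>

theorem corollary5:
  fixes P :: "('a::{field,finite} ^ 'n) set"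
    and q n m t :: nat and \<epsilon> :: real
  assumes "q = CARD('a)" and "n = CARD('n)"
    and "1 \<le> m" and "m \<le> n - 1"
    and "\<epsilon> \<ge> 0" and "t \<ge> 2"
    and "real (card P) \<ge> (1 + \<epsilon>) * (real t - 1) * real q ^ (n - m)"
  shows "real (num_rich_flats m t P) \<ge> rich_coeff \<epsilon> t * real q ^ ((m + 1) * (n - m))"
proof -
  have "m \<le> CARD('n)" using assms by simp
  then obtain S :: "'n set" where S: "card S = m"
    by (meson obtain_subset_with_card_n)
  have cS: "card (- S) = n - m"
    using S assms by (simp add: Compl_eq_Diff_UNIV card_Diff_subset)
  define D where "D = real q ^ (n - m)"
  have D: "D > 0" by (simp add: D_def assms(1))
  define K where "K = (affine_maps S :: ('n \<Rightarrow> 'a \<times> ('n \<Rightarrow> 'a)) set)"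
  define X where "X k = real (card (graph_flat S k \<inter> P))" for k
  define \<mu> where "\<mu> = real (card P) / D"
  have pow: "real ((CARD('a) ^ e) ^ (n - m)) = D ^ e" for e
    by (simp add: D_def assms(1) power_mult[symmetric] mult.commute)
  have cK: "real (card K) = D ^ (m + 1)"
    unfolding K_def card_affine_maps S cS by (rule pow)
  have first: "(\<Sum>k\<in>K. X k) = real (card P) * D ^ m"
    unfolding K_def X_def of_nat_sum[symmetric] sum_card_graph_flat S cS of_nat_mult pow ..
  have "(\<Sum>k\<in>K. (X k)\<^sup>2) \<le> real (card P) * D ^ m + (real (card P))\<^sup>2 * D ^ (m - 1)"
    using of_nat_mono[where 'a = real, OF sum_card_graph_flat_square[of S P]]
    unfolding K_def X_def S cS of_nat_sum of_nat_mult of_nat_add of_nat_power[symmetric] pow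
    by (simp add: pow)
  also have "\<dots> = real (card K) * (\<mu> + \<mu>\<^sup>2)"
  proof -
    obtain r where "m = Suc r" using assms(3) by (cases m) auto
    then show ?thesis using D by (simp add: cK \<mu>_def power2_eq_square field_simps)
  qed
  finally have second: "(\<Sum>k\<in>K. (X k)\<^sup>2) \<le> real (card K) * (\<mu> + \<mu>\<^sup>2)" .
  have mean: "(\<Sum>k\<in>K. X k) = real (card K) * \<mu>"
    using D by (simp add: first cK \<mu>_def)
  have "rich_coeff \<epsilon> t * real (card K) \<le> real (card {k \<in> K. real t - 1 < X k})"
    unfolding rich_coeff_def
  proof (rule second_moment_bound[OF _ mean second])
    show "finite K" by (simp add: K_def)
    show "(1 + \<epsilon>) * (real t - 1) \<le> \<mu>"
      using assms(7) D by (simp add: \<mu>_def D_def[symmetric] le_divide_eq)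
  qed (use assms in auto)
  also have "{k \<in> K. real t - 1 < X k} = {k \<in> K. rich t P (graph_flat S k)}"
    by (auto simp: rich_def X_def)
  also have "card \<dots> = card (graph_flat S ` {k \<in> K. rich t P (graph_flat S k)})"
    by (intro card_image[symmetric] inj_on_subset[OF inj_on_graph_flat]) (auto simp: K_def)
  also have "real \<dots> \<le> real (num_rich_flats m t P)"
    unfolding num_rich_flats_def of_nat_le_iff using is_flat_graph_flat[of S] S
    by (intro card_mono) auto
  also have "real (card K) = real q ^ ((m + 1) * (n - m))"
    by (simp only: cK D_def power_mult[symmetric] mult.commute)
  finally show ?thesis .
qed

end
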